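(* Let the intensities be $$\lambda^{(m)}(t)=\mu^{(m)}(t)+\sum_{l=1}^M\ \sum_{i:\,t_{l,i}\le t-1} Y^{(l)}_{t_{l,i}}\, f_{l,m}(\mathrm{mk}_l(t_{l,i}))\, g_{l,m}(t-t_{l,i}),\qquad t=1,\dots,N_\delta,\ m=1,\dots,M,$$ where each $g_{l,m}$ is a probability mass function on $\{1,2,3,\dots\}$. Then the log-likelihood $$\log L(\theta\mid\tau)=\sum_{t=1}^{N_\delta}\sum_{m=1}^M\Big(Y_t^{(m)}\log(\lambda^{(m)}(t))-\lambda^{(m)}(t)\Big)$$ can be rewritten as $$\log L(\theta\mid\tau)=\sum_{m=1}^M\sum_{t\in\tau^{(m)}}Y_t^{(m)}\log(\lambda^{(m)}(t))-\sum_{m=1}^M\sum_{l=1}^M\sum_{t\in\tau^{(l)}}Y_t^{(l)}f_{l,m}(\mathrm{mk}_l(t))\,G_{l,m}(N_\delta-t)-\sum_{m=1}^M\sum_{t=1}^{N_\delta}\mu^{(m)}(t),$$ where $G_{l,m}$ is the cumulative mass function of $g_{l,m}$.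
   Context: Fix integers $M\ge1$ (number of dimensions) and $N_\delta\ge1$ (number of discrete time steps). For $l\in\{1,\dots,M\}$ and $t\in\{1,\dots,N_\delta\}$, $Y_t^{(l)}\in\{0,1,2,\dots\}$ is the observed number of events in dimension $l$ at time step $t$. The set of arrival times in dimension $l$ is $\tau^{(l)}=\{t: Y^{(l)}_t>0\}=\{t_{l,1}<\dots<t_{l,N_l}\}$, and $\tau$ is the collection of all $\tau^{(l)}$. Each arrival time $t\in\tau^{(l)}$ carries a mark $\mathrm{mk}_l(t)$. The functions $\mu^{(m)}(t)>0$ are background rates, $f_{l,m}>0$ are positive functions of the mark, and $G_{l,m}(k)=\sum_{j=1}^{k}g_{l,m}(j)$ for integers $k\ge0$ (so $G_{l,m}(0)=0$). $\theta$ denotes the collection of model parameters. The log-likelihood is that of independent-given-the-past Poisson counts $Y^{(m)}_t\sim\mathrm{Poisson}(\lambda^{(m)}(t))$, with the parameter-free terms $-\log(Y_t^{(m)}!)$ omitted. *)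

theory Defs
  imports "HOL-Probability.Probability"
begin

text \<open>
  Dimensions are the numbers in \<open>{1..M}\<close>, time steps those in \<open>{1..N}\<close>, and \<open>Y l t\<close> is the
  number of events in dimension \<open>l\<close> at time \<open>t\<close>.
\<close>

definition arrivals :: "nat \<Rightarrow> (nat \<Rightarrow> nat \<Rightarrow> nat) \<Rightarrow> nat \<Rightarrow> nat set" where
  "arrivals N Y l = {t \<in> {1..N}. Y l t > 0}"

text \<open>
  \<open>arrival N Y l i\<close> is the \<open>i\<close>-th smallest arrival time in dimension \<open>l\<close>. It is meaningful only
  for \<open>1 \<le> i \<le> card (arrivals N Y l)\<close>, since list positions count from 0.
\<close>

definition arrival :: "nat \<Rightarrow> (nat \<Rightarrow> nat \<Rightarrow> nat) \<Rightarrow> nat \<Rightarrow> nat \<Rightarrow> nat" where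
  "arrival N Y l i = sorted_list_of_set (arrivals N Y l) ! (i - 1)"

text \<open>
  The natural-number subtractions below do not truncate: the intensity is used only for \<open>t \<ge> 1\<close>,
  and only arrival times before \<open>t\<close> contribute. Marks may have any type.
\<close>

definition intensity ::
  "nat \<Rightarrow> nat \<Rightarrow> (nat \<Rightarrow> nat \<Rightarrow> nat) \<Rightarrow> (nat \<Rightarrow> nat \<Rightarrow> 'k) \<Rightarrow> (nat \<Rightarrow> nat \<Rightarrow> real) \<Rightarrow>
   (nat \<Rightarrow> nat \<Rightarrow> 'k \<Rightarrow> real) \<Rightarrow> (nat \<Rightarrow> nat \<Rightarrow> nat pmf) \<Rightarrow> nat \<Rightarrow> nat \<Rightarrow> real" where
  "intensity M N Y mk \<mu> f g m t =
     \<mu> m t + (\<Sum>l = 1..M. \<Sum>i \<in> {i \<in> {1..card (arrivals N Y l)}. arrival N Y l i \<le> t - 1}.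
       real (Y l (arrival N Y l i)) * f l m (mk l (arrival N Y l i)) *
       pmf (g l m) (t - arrival N Y l i))"

definition cumulative_mass :: "nat pmf \<Rightarrow> nat \<Rightarrow> real" where
  "cumulative_mass p k = (\<Sum>j = 1..k. pmf p j)"

definition log_lik :: "nat \<Rightarrow> nat \<Rightarrow> (nat \<Rightarrow> nat \<Rightarrow> nat) \<Rightarrow> (nat \<Rightarrow> nat \<Rightarrow> real) \<Rightarrow> real" where
  "log_lik M N Y lam =
     (\<Sum>t = 1..N. \<Sum>m = 1..M. real (Y m t) * ln (lam m t) - lam m t)"

text \<open>
  The likelihood is a product of Poisson probabilities; \<^const>\<open>log_lik\<close> omits the terms
  \<open>- ln (fact (Y m t))\<close>, which do not depend on the parameters.
\<close>

lemma ln_poisson_likelihood: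
  assumes "\<And>m t. m \<in> {1..M} \<Longrightarrow> t \<in> {1..N} \<Longrightarrow> lam m t > 0"
  shows "ln (\<Prod>t = 1..N. \<Prod>m = 1..M. pmf (poisson_pmf (lam m t)) (Y m t)) =
         log_lik M N Y lam - (\<Sum>t = 1..N. \<Sum>m = 1..M. ln (fact (Y m t)))"
proof -
  have nz: "pmf (poisson_pmf (lam m t)) (Y m t) \<noteq> 0" if "m \<in> {1..M}" "t \<in> {1..N}" for m t
    using assms[OF that] by auto
  have term_eq: "ln (pmf (poisson_pmf (lam m t)) (Y m t)) =
      (real (Y m t) * ln (lam m t) - lam m t) - ln (fact (Y m t))"
    if "m \<in> {1..M}" "t \<in> {1..N}" for m t
    using assms[OF that] by (simp add: ln_mult ln_div ln_realpow)
  have "ln (\<Prod>t = 1..N. \<Prod>m = 1..M. pmf (poisson_pmf (lam m t)) (Y m t)) =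
      (\<Sum>t = 1..N. ln (\<Prod>m = 1..M. pmf (poisson_pmf (lam m t)) (Y m t)))"
    by (rule ln_prod) (use nz in auto)
  also have "\<dots> = (\<Sum>t = 1..N. \<Sum>m = 1..M. ln (pmf (poisson_pmf (lam m t)) (Y m t)))"
    by (intro sum.cong refl ln_prod) (use nz in auto)
  also have "\<dots> = (\<Sum>t = 1..N. \<Sum>m = 1..M.
      (real (Y m t) * ln (lam m t) - lam m t) - ln (fact (Y m t)))"
    by (intro sum.cong refl term_eq) auto
  also have "\<dots> = log_lik M N Y lam - (\<Sum>t = 1..N. \<Sum>m = 1..M. ln (fact (Y m t)))"
    by (simp add: log_lik_def sum_subtractf)
  finally show ?thesis .
qed

end

theory Submission
  imports Defs
begin

text \<open>Split the log-likelihood into a logarithmic part and the total intensity. In the former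
  only arrival times survive, because the count is zero elsewhere
  (\<open>sum_count_arrivals\<close>). In the latter, interchange the finite sums over the current
  time t and the past arrival s (\<open>sum_excitation\<close>): the arrival at s contributes its
  weight times the mass of all delays t - s that still end by time N, which is the cumulative mass
  at N - s (\<open>sum_pmf_delay\<close>). The indexing of arrivals by rank is first replaced by
  summation over the arrival set (\<open>sum_arrival\<close>).\<close>

lemma finite_arrivals: "finite (arrivals N Y l)"
  by (simp add: arrivals_def)

text \<open>The sorted list of a finite set lists each element exactly once.\<close>

lemma bij_betw_arrival:
  "bij_betw (arrival N Y l) {1..card (arrivals N Y l)} (arrivals N Y l)"
proof -
  let ?xs = "sorted_list_of_set (arrivals N Y l)"
  have nth: "bij_betw ((!) ?xs) {..<card (arrivals N Y l)} (arrivals N Y l)"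
    by (rule bij_betw_nth) (simp_all add: finite_arrivals)
  \<comment> \<open>Ranks start at 1 and list positions at 0, so the enumeration is this shift
    followed by list lookup.\<close>
  have pred: "bij_betw (\<lambda>i. i - 1) {1..card (arrivals N Y l)} {..<card (arrivals N Y l)}"
    by (rule bij_betw_byWitness[where f' = Suc]) auto
  show ?thesis
    using bij_betw_trans[OF pred nth] by (simp add: arrival_def[abs_def] comp_def)
qed

text \<open>Reindexing along the enumeration of arrivals; \<open>P\<close> will be the cutoff that
  keeps only the past.\<close>

lemma sum_arrival:
  fixes h :: "nat \<Rightarrow> 'b::comm_monoid_add"
  shows "(\<Sum>i \<in> {i \<in> {1..card (arrivals N Y l)}. P (arrival N Y l i)}. h (arrival N Y l i)) =
    (\<Sum>s \<in> {s \<in> arrivals N Y l. P s}. h s)"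
proof -
  let ?I = "{i \<in> {1..card (arrivals N Y l)}. P (arrival N Y l i)}"
  have "inj_on (arrival N Y l) ?I"
    by (rule inj_on_subset[OF bij_betw_imp_inj_on[OF bij_betw_arrival]]) blast
  moreover have "arrival N Y l ` ?I = {s \<in> arrival N Y l ` {1..card (arrivals N Y l)}. P s}"
    by blast
  hence "arrival N Y l ` ?I = {s \<in> arrivals N Y l. P s}"
    by (simp only: bij_betw_imp_surj_on[OF bij_betw_arrival])
  ultimately have "bij_betw (arrival N Y l) ?I {s \<in> arrivals N Y l. P s}"
    by (simp only: bij_betw_def)
  from sum.reindex_bij_betw[OF this] show ?thesis .
qed

text \<open>For t in \<open>{1..N}\<close> the condition \<open>s \<le> t - 1\<close> means s < t,
  so the delay t - s runs exactly once through \<open>{1..N - s}\<close>; both sums are empty when s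
  \<ge> N.\<close>

lemma sum_pmf_delay:
  "(\<Sum>t \<in> {t \<in> {1..N}. s \<le> t - 1}. pmf p (t - s)) = cumulative_mass p (N - s)"
  if "s \<ge> 1"
  unfolding cumulative_mass_def using that
  by (intro sum.reindex_bij_witness[where i = "\<lambda>j. j + s" and j = "\<lambda>t. t - s"]) auto

lemma sum_excitation:
  fixes c :: "nat \<Rightarrow> real"
  assumes "finite A" and "\<And>s. s \<in> A \<Longrightarrow> s \<ge> 1"
  shows "(\<Sum>t = 1..N. \<Sum>s \<in> {s \<in> A. s \<le> t - 1}. c s * pmf p (t - s)) =
    (\<Sum>s \<in> A. c s * cumulative_mass p (N - s))"
proof -
  have "(\<Sum>t = 1..N. \<Sum>s \<in> {s \<in> A. s \<le> t - 1}. c s * pmf p (t - s)) =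
      (\<Sum>s \<in> A. \<Sum>t \<in> {t \<in> {1..N}. s \<le> t - 1}. c s * pmf p (t - s))"
    using assms(1) by (intro sum.swap_restrict) auto
  also have "\<dots> = (\<Sum>s \<in> A. c s * cumulative_mass p (N - s))"
    using assms(2) by (intro sum.cong refl) (simp only: sum_pmf_delay flip: sum_distrib_left)
  finally show ?thesis .
qed

lemma sum_intensity:
  "(\<Sum>t = 1..N. intensity M N Y mk \<mu> f g m t) =
    (\<Sum>t = 1..N. \<mu> m t) + (\<Sum>l = 1..M. \<Sum>t \<in> arrivals N Y l.
      real (Y l t) * f l m (mk l t) * cumulative_mass (g l m) (N - t))"
proof -
  let ?c = "\<lambda>l s. real (Y l s) * f l m (mk l s)"
  have "intensity M N Y mk \<mu> f g m t = \<mu> m t +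
      (\<Sum>l = 1..M. \<Sum>s \<in> {s \<in> arrivals N Y l. s \<le> t - 1}. ?c l s * pmf (g l m) (t - s))" for t
    unfolding intensity_def
    using sum_arrival[where P = "\<lambda>s. s \<le> t - 1" and h = "\<lambda>s. ?c l s * pmf (g l m) (t - s)" for l]
    by (simp only:)
  hence "(\<Sum>t = 1..N. intensity M N Y mk \<mu> f g m t) = (\<Sum>t = 1..N. \<mu> m t) +
      (\<Sum>t = 1..N. \<Sum>l = 1..M. \<Sum>s \<in> {s \<in> arrivals N Y l. s \<le> t - 1}.
        ?c l s * pmf (g l m) (t - s))"
    by (simp only: sum.distrib)
  also have "\<dots> = (\<Sum>t = 1..N. \<mu> m t) +
      (\<Sum>l = 1..M. \<Sum>t = 1..N. \<Sum>s \<in> {s \<in> arrivals N Y l. s \<le> t - 1}.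
        ?c l s * pmf (g l m) (t - s))"
    \<comment> \<open>With the dimension outermost, the time sum meets one arrival set at a time, as
      \<open>sum_excitation\<close> requires.\<close>
    by (subst sum.swap) (rule refl)
  also have "\<dots> = (\<Sum>t = 1..N. \<mu> m t) +
      (\<Sum>l = 1..M. \<Sum>s \<in> arrivals N Y l. ?c l s * cumulative_mass (g l m) (N - s))"
    by (subst sum_excitation) (auto simp: finite_arrivals arrivals_def)
  finally show ?thesis .
qed

text \<open>Off the arrival set the factor \<open>Y m t\<close> is zero, whatever the value of
  \<open>h\<close>.\<close>

lemma sum_count_arrivals:
  "(\<Sum>t = 1..N. real (Y m t) * h t) = (\<Sum>t \<in> arrivals N Y m. real (Y m t) * h t)"
  by (rule sum.mono_neutral_right) (auto simp: arrivals_def)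

theorem proposition5p1:
  fixes M N :: nat
    and Y :: "nat \<Rightarrow> nat \<Rightarrow> nat"
    and mk :: "nat \<Rightarrow> nat \<Rightarrow> 'k"
    and \<mu> :: "nat \<Rightarrow> nat \<Rightarrow> real"
    and f :: "nat \<Rightarrow> nat \<Rightarrow> 'k \<Rightarrow> real"
    and g :: "nat \<Rightarrow> nat \<Rightarrow> nat pmf"
  assumes "M \<ge> 1" and "N \<ge> 1"
    and "\<And>m t. m \<in> {1..M} \<Longrightarrow> t \<in> {1..N} \<Longrightarrow> \<mu> m t > 0"
    and "\<And>l m x. l \<in> {1..M} \<Longrightarrow> m \<in> {1..M} \<Longrightarrow> f l m x > 0"
    and "\<And>l m. l \<in> {1..M} \<Longrightarrow> m \<in> {1..M} \<Longrightarrow> set_pmf (g l m) \<subseteq> {1..}"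
  shows "log_lik M N Y (intensity M N Y mk \<mu> f g) =
    (\<Sum>m = 1..M. \<Sum>t \<in> arrivals N Y m. real (Y m t) * ln (intensity M N Y mk \<mu> f g m t))
    - (\<Sum>m = 1..M. \<Sum>l = 1..M. \<Sum>t \<in> arrivals N Y l.
        real (Y l t) * f l m (mk l t) * cumulative_mass (g l m) (N - t))
    - (\<Sum>m = 1..M. \<Sum>t = 1..N. \<mu> m t)"
proof -
  let ?lam = "intensity M N Y mk \<mu> f g"
  have "log_lik M N Y ?lam =
      (\<Sum>m = 1..M. (\<Sum>t = 1..N. real (Y m t) * ln (?lam m t)) - (\<Sum>t = 1..N. ?lam m t))"
    unfolding log_lik_def by (subst sum.swap) (simp only: sum_subtractf)
  thus ?thesis
    \<comment> \<open>Fixing \<open>Y\<close> turns the left-hand side into a higher-order pattern,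
      which \<open>?Y ?m t\<close> would not be.\<close>
    by (simp only: sum_count_arrivals[of Y] sum_intensity sum_subtractf sum.distrib)
qed

end
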